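(* Let $n\ge1$ be an integer and let $(Y_t)_{t\ge0}$ be the bounding chain (defined in the context) for the transposition chain on permutations of $n$ objects, started with $Y_0(v)=\{1,\ldots,n\}$ for all positions $v$. Let $\tau$ be the first time the bounding chain detects complete coupling, i.e. the first $t$ such that $|Y_t(v)|=1$ for all $v\in\{1,\ldots,n\}$. Then $$E[\tau]\le\frac{\pi^2}{6}n^2\qquad\text{and}\qquad P(\tau>C\,E[\tau])\le e^{-0.18C}\quad\text{for all real } C\ge2.$$
   Context: Permutations are written as $x\in\{1,\ldots,n\}^{\{1,\ldots,n\}}$ with distinct entries; $x(i)=j$ is read as "item $j$ is in position $i$". Transposition chain with complete coupling: at each step choose an item $i$ and a position $j$ independently and uniformly from $\{1,\ldots,n\}$ (the same choice for all states), and swap item $i$ with the item in position $j$, so that item $i$ ends in position $j$ and the item formerly in position $j$ ends in the former position of item $i$. Bounding chain: a state $Y$ assigns to each position a subset of $\{1,\ldots,n\}$. A position is known if its set has size 1 and unknown otherwise; unknown positions always carry the set $\{1,\ldots,n\}$. An item is known if some known position has that item as its unique element. One step, with an item $i$ and a position $j$ chosen independently and uniformly from $\{1,\ldots,n\}$ (independently at each step): set $Y_{t+1}(j)=\{i\}$; if item $i$ is known in $Y_t$, at a position $p\ne j$ with $Y_t(p)=\{i\}$, set $Y_{t+1}(p)=Y_t(j)$; all other positions keep their sets. *)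

theory Defs
  imports "HOL-Probability.Probability"
begin

text \<open>Positions and items are the naturals in \<open>{1..n}\<close>. A state of the bounding chain maps positions
  to sets of items; its values outside \<open>{1..n}\<close> play no role.\<close>

type_synonym bstate = "nat \<Rightarrow> nat set"

definition bounding_init :: "nat \<Rightarrow> bstate" where
  "bounding_init n = (\<lambda>v. {1..n})"

text \<open>The second case applies only if item \<open>i\<close> is known. In every state reachable from
  \<open>bounding_init n\<close> a known item sits at exactly one position of \<open>{1..n}\<close>, so at most one \<open>v \<noteq> j\<close>
  falls under it.\<close>

definition bounding_step :: "nat \<Rightarrow> nat \<Rightarrow> nat \<Rightarrow> bstate \<Rightarrow> bstate" where
  "bounding_step n i j Y = (\<lambda>v.
     if v = j then {i}
     else if v \<in> {1..n} \<and> Y v = {i} then Y j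
     else Y v)"

primrec bounding_chain :: "nat \<Rightarrow> (nat \<Rightarrow> nat \<times> nat) \<Rightarrow> nat \<Rightarrow> bstate" where
  "bounding_chain n x 0 = bounding_init n"
| "bounding_chain n x (Suc t) =
     bounding_step n (fst (x t)) (snd (x t)) (bounding_chain n x t)"

text \<open>The value is \<open>\<infinity>\<close> (the infimum of the empty set) if complete coupling is never detected.\<close>

definition detection_time :: "nat \<Rightarrow> (nat \<Rightarrow> nat \<times> nat) \<Rightarrow> enat" where
  "detection_time n x = Inf (enat ` {t. \<forall>v\<in>{1..n}. card (bounding_chain n x t v) = 1})"

text \<open>The law of one choice (item, position): independent and uniform on \<open>{1..n}\<close>.\<close>

definition choice_pmf :: "nat \<Rightarrow> (nat \<times> nat) pmf" where
  "choice_pmf n = pair_pmf (pmf_of_set {1..n}) (pmf_of_set {1..n})"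

end

theory Submission
  imports Defs
begin

text \<open>The number of unknown positions equals the number of unknown items. It never grows, and it drops
  from \<open>k\<close> to \<open>k - 1\<close> exactly when both the chosen item and the chosen position are unknown, so with
  probability \<open>k\<^sup>2/n\<^sup>2\<close>. Summing the mean waiting times \<open>n\<^sup>2/k\<^sup>2\<close> bounds the expectation. For the tail,
  an eigenfunction of this death chain gives \<open>P(\<tau> > t) \<le> 2 (1 - 1/n\<^sup>2)\<^sup>t\<close>; as the last waiting time alone
  has mean \<open>n\<^sup>2\<close>, at time \<open>C E[\<tau>] \<ge> C n\<^sup>2\<close> this is about \<open>2 exp(-C)\<close>, which suffices for \<open>C \<ge> 2\<close>.
  The case \<open>n = 1\<close> is separate, because there every position is known from the start.\<close>


section \<open>Combinatorics of one step of the bounding chain\<close>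

definition known_items :: "nat \<Rightarrow> bstate \<Rightarrow> nat set" where
  "known_items n Y = {i. \<exists>v\<in>{1..n}. Y v = {i}}"

text \<open>The invariant of the reachable states. Its second half is what makes known items and
  known positions correspond one to one.\<close>

definition valid_state :: "nat \<Rightarrow> bstate \<Rightarrow> bool" where
  "valid_state n Y \<longleftrightarrow>
     (\<forall>v\<in>{1..n}. Y v = {1..n} \<or> (\<exists>i\<in>{1..n}. Y v = {i})) \<and>
     (\<forall>v\<in>{1..n}. \<forall>w\<in>{1..n}. \<forall>i. Y v = {i} \<longrightarrow> Y w = {i} \<longrightarrow> v = w)"

definition unknown :: "nat \<Rightarrow> bstate \<Rightarrow> nat" where
  "unknown n Y = card {v\<in>{1..n}. card (Y v) \<noteq> 1}"

lemma full_ne_singleton: "{1..n} \<noteq> {i}" if "n \<ge> 2" for n i :: nat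
proof
  assume "{1..n} = {i}"
  then have "card {1..n} = card {i}" by simp
  with that show False by simp
qed

lemma valid_state_cases:
  "valid_state n Y \<Longrightarrow> v \<in> {1..n} \<Longrightarrow> Y v = {1..n} \<or> (\<exists>i\<in>{1..n}. Y v = {i})"
  unfolding valid_state_def by blast

lemma valid_state_inj:
  "valid_state n Y \<Longrightarrow> v \<in> {1..n} \<Longrightarrow> w \<in> {1..n} \<Longrightarrow> Y v = {i} \<Longrightarrow> Y w = {i} \<Longrightarrow> v = w"
  unfolding valid_state_def by blast

lemma valid_init: "n \<ge> 2 \<Longrightarrow> valid_state n (bounding_init n)"
  using full_ne_singleton[of n] by (auto simp: valid_state_def bounding_init_def)

lemma unknown_init:
  assumes "n \<ge> 2"
  shows "unknown n (bounding_init n) = n"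
proof -
  have "{v\<in>{1..n}. card (bounding_init n v) \<noteq> 1} = {1..n}"
    using assms by (auto simp: bounding_init_def)
  then show ?thesis by (simp add: unknown_def)
qed

lemma unknown_le: "unknown n Y \<le> n"
proof -
  have "unknown n Y \<le> card {1..n}"
    unfolding unknown_def by (rule card_mono) auto
  then show ?thesis by simp
qed

lemma unknown_eq_0_iff: "unknown n Y = 0 \<longleftrightarrow> (\<forall>v\<in>{1..n}. card (Y v) = 1)"
  by (auto simp: unknown_def)

lemma known_items_subset:
  assumes "valid_state n Y" "n \<ge> 2"
  shows "known_items n Y \<subseteq> {1..n}"
proof
  fix i assume "i \<in> known_items n Y"
  then obtain v where v: "v \<in> {1..n}" "Y v = {i}" by (auto simp: known_items_def)
  with valid_state_cases[OF assms(1)] have "{i} = {1..n} \<or> (\<exists>m\<in>{1..n}. {i} = {m})"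
    by metis
  then obtain m where "m \<in> {1..n}" "{i} = {m}"
    using full_ne_singleton[OF assms(2), of i] by metis
  then show "i \<in> {1..n}" by simp
qed

text \<open>By injectivity, \<open>Y\<close> maps the known positions bijectively onto the
  singletons of the known items. Hence positions and items have the same number of unknowns.\<close>

lemma card_known_items:
  assumes "valid_state n Y" "n \<ge> 2"
  shows "unknown n Y + card (known_items n Y) = n"
proof -
  let ?K = "{v\<in>{1..n}. card (Y v) = 1}"
  have "bij_betw Y ?K ((\<lambda>i. {i}) ` known_items n Y)"
    unfolding bij_betw_def
  proof
    show "inj_on Y ?K"
    proof (rule inj_onI)
      fix v w assume "v \<in> ?K" "w \<in> ?K" "Y v = Y w"
      then show "v = w"
        using valid_state_inj[OF assms(1), of v w] by (auto simp: card_1_singleton_iff)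
    qed
    show "Y ` ?K = (\<lambda>i. {i}) ` known_items n Y"
    proof (intro equalityI subsetI)
      fix A assume "A \<in> Y ` ?K"
      then obtain v where v: "v \<in> {1..n}" "card (Y v) = 1" "A = Y v"
        by blast
      then obtain i where "Y v = {i}"
        using card_1_singletonE by blast
      with v show "A \<in> (\<lambda>i. {i}) ` known_items n Y"
        unfolding known_items_def by blast
    next
      fix A assume "A \<in> (\<lambda>i. {i}) ` known_items n Y"
      then obtain v i where "v \<in> {1..n}" "Y v = {i}" "A = {i}"
        unfolding known_items_def by blast
      then show "A \<in> Y ` ?K" by (intro image_eqI[of _ _ v]) auto
    qed
  qed
  then have "card ?K = card ((\<lambda>i. {i}) ` known_items n Y)"
    by (rule bij_betw_same_card)
  also have "\<dots> = card (known_items n Y)"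
    by (rule card_image) auto
  finally have "card ?K = card (known_items n Y)" .
  moreover have "card {v\<in>{1..n}. card (Y v) \<noteq> 1} + card ?K
      = card ({v\<in>{1..n}. card (Y v) \<noteq> 1} \<union> ?K)"
    by (rule card_Un_disjoint[symmetric]) auto
  moreover have "{v\<in>{1..n}. card (Y v) \<noteq> 1} \<union> ?K = {1..n}" by auto
  ultimately show ?thesis by (simp add: unknown_def)
qed

lemma valid_step:
  assumes "valid_state n Y" "n \<ge> 2" "i \<in> {1..n}" "j \<in> {1..n}"
  shows "valid_state n (bounding_step n i j Y)"
  unfolding valid_state_def
proof (intro conjI ballI allI impI)
  fix v assume "v \<in> {1..n}"
  moreover have "bounding_step n i j Y v \<in> {{i}, Y j, Y v}"
    by (simp add: bounding_step_def)
  ultimately show "bounding_step n i j Y v = {1..n} \<or> (\<exists>m\<in>{1..n}. bounding_step n i j Y v = {m})"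
    using valid_state_cases[OF assms(1)] assms(3,4) by (metis insertE singletonD)
next
  fix v w m assume v: "v \<in> {1..n}" and w: "w \<in> {1..n}"
    and eq: "bounding_step n i j Y v = {m}" "bounding_step n i j Y w = {m}"
  \<comment> \<open>Origin of a set \<open>{m}\<close> found at \<open>u\<close> after the step:
    item \<open>i\<close> occurs only at \<open>j\<close>; any other item either came from
    \<open>j\<close> to the former place of \<open>i\<close>, or has not moved.\<close>
  have *: "m = i \<Longrightarrow> u = j" "m \<noteq> i \<Longrightarrow> (u \<noteq> j \<and> Y u = {i} \<and> Y j = {m}) \<or> (u \<noteq> j \<and> Y u = {m})"
    if u: "u \<in> {1..n}" "bounding_step n i j Y u = {m}" for u
    using u valid_state_inj[OF assms(1) u(1) assms(4), of i]
    unfolding bounding_step_def by (metis singleton_inject)+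
  show "v = w"
    using *[OF v eq(1)] *[OF w eq(2)] valid_state_inj[OF assms(1) v w, of i]
      valid_state_inj[OF assms(1) v w, of m] valid_state_inj[OF assms(1) assms(4) w, of m]
      valid_state_inj[OF assms(1) v assms(4), of m]
    by metis
qed

text \<open>If \<open>i\<close> is known, the step swaps the contents of two positions and loses
  nothing. Otherwise \<open>j\<close> receives \<open>i\<close> and its former content is lost;
  \<open>{m. Y j = {m}}\<close> holds the lost item, and is empty if \<open>j\<close> was
  unknown.\<close>

lemma known_items_step:
  assumes "valid_state n Y" "n \<ge> 2" "i \<in> {1..n}" "j \<in> {1..n}"
  shows "known_items n (bounding_step n i j Y) =
    (if i \<in> known_items n Y then known_items n Y
     else insert i (known_items n Y - {m. Y j = {m}}))"
proof (cases "i \<in> known_items n Y")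
  case True
  then obtain p where p: "p \<in> {1..n}" "Y p = {i}" by (auto simp: known_items_def)
  have "m \<in> known_items n (bounding_step n i j Y) \<longleftrightarrow> m \<in> known_items n Y" for m
  proof
    assume "m \<in> known_items n (bounding_step n i j Y)"
    then show "m \<in> known_items n Y"
      using assms(4) p by (auto simp: known_items_def bounding_step_def split: if_splits)
  next
    assume "m \<in> known_items n Y"
    then obtain v where v: "v \<in> {1..n}" "Y v = {m}" by (auto simp: known_items_def)
    \<comment> \<open>The position of \<open>m\<close> after the swap: \<open>i\<close> goes to
      \<open>j\<close>, the content of \<open>j\<close> to \<open>p\<close>, and the rest
      stays.\<close>
    let ?w = "if m = i then j else if v = j then p else v"
    have "?w \<in> {1..n}" "bounding_step n i j Y ?w = {m}"
      using v p assms(4) by (auto simp: bounding_step_def)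
    then show "m \<in> known_items n (bounding_step n i j Y)"
      unfolding known_items_def by blast
  qed
  with True show ?thesis by auto
next
  case False
  then have 3: "\<And>v. v \<in> {1..n} \<Longrightarrow> Y v \<noteq> {i}" by (auto simp: known_items_def)
  then have 4: "bounding_step n i j Y v = (if v = j then {i} else Y v)" for v
    by (auto simp: bounding_step_def)
  have "m \<in> known_items n (bounding_step n i j Y)
      \<longleftrightarrow> m \<in> insert i (known_items n Y - {m. Y j = {m}})" for m
  proof
    assume "m \<in> known_items n (bounding_step n i j Y)"
    then obtain v where v: "v \<in> {1..n}" "(if v = j then {i} else Y v) = {m}"
      unfolding known_items_def 4 by blast
    then show "m \<in> insert i (known_items n Y - {m. Y j = {m}})"
      using valid_state_inj[OF assms(1) v(1) assms(4), of m]
      by (auto simp: known_items_def split: if_splits)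
  next
    assume m: "m \<in> insert i (known_items n Y - {m. Y j = {m}})"
    show "m \<in> known_items n (bounding_step n i j Y)"
    proof (cases "m = i")
      case True
      then show ?thesis
        unfolding known_items_def 4 using assms(4) by (intro CollectI bexI[of _ j]) simp_all
    next
      case False
      with m obtain v where "v \<in> {1..n}" "Y v = {m}" "Y j \<noteq> {m}"
        unfolding known_items_def by blast
      moreover from this have "v \<noteq> j" by blast
      ultimately show ?thesis
        unfolding known_items_def 4 by (intro CollectI bexI[of _ v]) simp_all
    qed
  qed
  with False show ?thesis by auto
qed

text \<open>It suffices to follow the known items: an unknown item put on an unknown position adds
  one, put on a known position it merely replaces the item there.\<close>

lemma unknown_step:
  assumes "valid_state n Y" "n \<ge> 2" "i \<in> {1..n}" "j \<in> {1..n}"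
  shows "unknown n (bounding_step n i j Y) =
    (if i \<notin> known_items n Y \<and> card (Y j) \<noteq> 1 then unknown n Y - 1 else unknown n Y)"
proof -
  let ?I = "known_items n Y" and ?I' = "known_items n (bounding_step n i j Y)"
  have fin: "finite ?I"
    using known_items_subset[OF assms(1,2)] finite_subset by blast
  have eq: "unknown n Y + card ?I = n" "unknown n (bounding_step n i j Y) + card ?I' = n"
    using card_known_items assms valid_step by blast+
  consider "i \<in> ?I" | "i \<notin> ?I" "card (Y j) \<noteq> 1" | m where "i \<notin> ?I" "Y j = {m}"
    using card_1_singletonE by blast
  then show ?thesis
  proof cases
    case 1
    with known_items_step[OF assms] eq show ?thesis by simp
  next
    case 2
    then have "{m. Y j = {m}} = {}" by auto
    with 2 known_items_step[OF assms] have "?I' = insert i ?I" by simp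
    with 2 fin eq show ?thesis by simp
  next
    case 3
    then have m: "m \<in> ?I" using assms(4) by (auto simp: known_items_def)
    have "{m. Y j = {m}} = {m}" using 3 by auto
    with 3 known_items_step[OF assms] have "?I' = insert i (?I - {m})" by simp
    moreover have "i \<noteq> m" using 3 m by auto
    moreover have "card ?I > 0" using m fin by (auto simp: card_gt_0_iff)
    ultimately have "card ?I' = card ?I" using 3 m fin by simp
    with 3 eq show ?thesis by simp
  qed
qed

section \<open>Mean effect of one step on a function of the unknown count\<close>

lemma choice_pmf_eq:
  assumes "n \<ge> 1"
  shows "choice_pmf n = pmf_of_set ({1..n} \<times> {1..n})"
proof (rule pmf_eqI)
  fix x :: "nat \<times> nat"
  have ne: "{1..n} \<noteq> {}" "{1..n} \<times> {1..n} \<noteq> {}" using assms by auto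
  show "pmf (choice_pmf n) x = pmf (pmf_of_set ({1..n} \<times> {1..n})) x"
    using ne by (cases x) (simp add: choice_pmf_def pmf_pair card_cartesian_product indicator_def)
qed

text \<open>There are \<open>k\<close> unknown items and \<open>k\<close> unknown positions, so
  \<open>k * k\<close> of the \<open>n * n\<close> equally likely choices lower the count. The
  function \<open>f\<close> is left general because an eigenfunction, an indicator and a mean
  absorption time are all inserted later.\<close>

lemma nn_integral_step:
  fixes f :: "nat \<Rightarrow> real"
  assumes v: "valid_state n Y" "n \<ge> 2" and f: "\<And>k. f k \<ge> 0"
  defines "k \<equiv> unknown n Y"
  shows "(\<integral>\<^sup>+x. ennreal (f (unknown n (bounding_step n (fst x) (snd x) Y))) \<partial>choice_pmf n) =
    ennreal (f k + (real k / real n)\<^sup>2 * (f (k - 1) - f k))"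
proof -
  let ?S = "{1..n} \<times> {1..n}"
  \<comment> \<open>The choices that lower the count.\<close>
  let ?T = "({1..n} - known_items n Y) \<times> {v\<in>{1..n}. card (Y v) \<noteq> 1}"
  have kn: "known_items n Y \<subseteq> {1..n}" by (rule known_items_subset[OF v])
  then have fin: "finite (known_items n Y)" using finite_subset by blast
  have "card ({1..n} - known_items n Y) = n - card (known_items n Y)"
    using card_Diff_subset[OF fin kn] by simp
  also have "\<dots> = k" using card_known_items[OF v] by (simp add: k_def)
  finally have T: "card ?T = k\<^sup>2"
    by (simp add: card_cartesian_product power2_eq_square k_def unknown_def)
  have T': "card (?S - ?T) = n\<^sup>2 - k\<^sup>2"
  proof -
    have "card (?S - ?T) = card ?S - card ?T" by (rule card_Diff_subset) auto
    then show ?thesis unfolding T by (simp add: card_cartesian_product power2_eq_square)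
  qed
  have kle: "k\<^sup>2 \<le> n\<^sup>2" using unknown_le[of n Y] by (simp add: k_def)
  have "(\<Sum>x\<in>?S. f (unknown n (bounding_step n (fst x) (snd x) Y)))
      = (\<Sum>x\<in>?S. if x \<in> ?T then f (k - 1) else f k)"
    by (rule sum.cong) (auto simp: unknown_step[OF v] k_def)
  also have "\<dots> = (\<Sum>x\<in>?S \<inter> ?T. f (k - 1)) + (\<Sum>x\<in>?S - ?T. f k)"
    by (subst sum.If_cases) (auto simp: Diff_eq)
  also have "?S \<inter> ?T = ?T" by auto
  also have "(\<Sum>x\<in>?T. f (k - 1)) + (\<Sum>x\<in>?S - ?T. f k)
      = (real k)\<^sup>2 * f (k - 1) + ((real n)\<^sup>2 - (real k)\<^sup>2) * f k"
    unfolding sum_constant T T' using kle by (simp add: of_nat_diff)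
  finally have sum: "(\<Sum>x\<in>?S. f (unknown n (bounding_step n (fst x) (snd x) Y)))
      = (real k)\<^sup>2 * f (k - 1) + ((real n)\<^sup>2 - (real k)\<^sup>2) * f k" .
  have nonneg: "0 \<le> (real k)\<^sup>2 * f (k - 1) + ((real n)\<^sup>2 - (real k)\<^sup>2) * f k"
    unfolding sum[symmetric] by (intro sum_nonneg f)
  have "(\<integral>\<^sup>+x. ennreal (f (unknown n (bounding_step n (fst x) (snd x) Y))) \<partial>choice_pmf n)
      = (\<Sum>x\<in>?S. ennreal (f (unknown n (bounding_step n (fst x) (snd x) Y)))) / ennreal (card ?S)"
    using v by (subst choice_pmf_eq, simp, subst nn_integral_pmf_of_set)
      (auto simp: ennreal_mult ennreal_of_nat_eq_real_of_nat)
  also have "\<dots> = ennreal (((real k)\<^sup>2 * f (k - 1) + ((real n)\<^sup>2 - (real k)\<^sup>2) * f k) / card ?S)"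
    using v f nonneg by (subst sum_ennreal, simp, subst sum, subst divide_ennreal) auto
  also have "((real k)\<^sup>2 * f (k - 1) + ((real n)\<^sup>2 - (real k)\<^sup>2) * f k) / card ?S
      = f k + (real k / real n)\<^sup>2 * (f (k - 1) - f k)"
    using v by (simp add: card_cartesian_product field_simps power2_eq_square)
  finally show ?thesis .
qed

section \<open>Trajectories and the detection time\<close>

lemma bounding_chain_cong:
  "(\<And>s. s < t \<Longrightarrow> x s = y s) \<Longrightarrow> bounding_chain n x t = bounding_chain n y t"
  by (induction t) auto

lemma valid_chain:
  assumes "n \<ge> 2" "\<And>s. x s \<in> {1..n} \<times> {1..n}"
  shows "valid_state n (bounding_chain n x t)"
proof (induction t)
  case 0
  show ?case using valid_init[OF assms(1)] by simp
next
  case (Suc t)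
  then show ?case using valid_step[OF Suc assms(1)] assms(2)[of t] by auto
qed

lemma unknown_chain_antimono:
  assumes "n \<ge> 2" "\<And>s. x s \<in> {1..n} \<times> {1..n}" "s \<le> t"
  shows "unknown n (bounding_chain n x t) \<le> unknown n (bounding_chain n x s)"
  using assms(3)
proof (induction rule: dec_induct)
  case (step t)
  have "unknown n (bounding_chain n x (Suc t)) \<le> unknown n (bounding_chain n x t)"
    using unknown_step[OF valid_chain[OF assms(1,2)] assms(1)] assms(2)[of t] by auto
  with step.IH show ?case by simp
qed simp

text \<open>All \<open>s \<le> t\<close> occur because \<open>x\<close> is arbitrary here: choices
  outside \<open>{1..n}\<close> can make a known position unknown again.\<close>

lemma less_detection_time_iff:
  "enat t < detection_time n x \<longleftrightarrow> (\<forall>s\<le>t. unknown n (bounding_chain n x s) \<noteq> 0)"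
proof -
  have "\<not> enat t < detection_time n x \<longleftrightarrow> (\<exists>s\<le>t. unknown n (bounding_chain n x s) = 0)"
    unfolding detection_time_def not_less unknown_eq_0_iff
  proof
    let ?A = "{t. \<forall>v\<in>{1..n}. card (bounding_chain n x t v) = 1}"
    assume le: "Inf (enat ` ?A) \<le> enat t"
    have ne: "enat ` ?A \<noteq> {}"
    proof
      assume "enat ` ?A = {}"
      with le have "Inf {} \<le> enat t" by (simp only:)
      then show False by (simp add: top_enat_def)
    qed
    then have "Inf (enat ` ?A) \<in> enat ` ?A"
      unfolding Inf_enat_def by (metis (mono_tags, lifting) LeastI_ex ex_in_conv)
    with le show "\<exists>s\<le>t. \<forall>v\<in>{1..n}. card (bounding_chain n x s v) = 1"
      by auto
  next
    assume "\<exists>s\<le>t. \<forall>v\<in>{1..n}. card (bounding_chain n x s v) = 1"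
    then obtain s where "s \<le> t" "\<forall>v\<in>{1..n}. card (bounding_chain n x s v) = 1" by blast
    then show "Inf (enat ` {t. \<forall>v\<in>{1..n}. card (bounding_chain n x t v) = 1}) \<le> enat t"
      by (intro Inf_lower2[of "enat s"]) auto
  qed
  then have "enat t < detection_time n x \<longleftrightarrow> \<not> (\<exists>s\<le>t. unknown n (bounding_chain n x s) = 0)"
    by argo
  then show ?thesis by simp
qed

text \<open>Pointwise form of the tail-sum formula; integrating it turns the expectation into a sum
  of tail probabilities, also when the time may be infinite.\<close>

lemma ennreal_of_enat_eq_suminf:
  "ennreal_of_enat m = (\<Sum>t. if enat t < m then 1 else 0)"
proof (cases m)
  case (enat k)
  have "(\<Sum>t. if enat t < m then 1 else 0 :: ennreal) = (\<Sum>t<k. if enat t < m then 1 else 0)"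
    by (rule suminf_finite) (auto simp: enat)
  then show ?thesis by (simp add: enat)
next
  case infinity
  have "of_nat N \<le> (\<Sum>t. 1 :: ennreal)" for N
    using sum_le_suminf[of "\<lambda>_. 1 :: ennreal" "{..<N}"] by simp
  then have "(\<Sum>t. 1 :: ennreal) = \<infinity>"
    by (metis ennreal_Ex_less_of_nat infinity_ennreal_def leD top.not_eq_extremum)
  then show ?thesis by (simp add: infinity)
qed

text \<open>Lists over a countable type are countable, so each new entry can be appended separately
  for every value of the prefix.\<close>

lemma measurable_map_upt:
  fixes f :: "nat \<Rightarrow> 'a \<Rightarrow> 'b :: countable"
  assumes "\<And>s. s < t \<Longrightarrow> f s \<in> measurable N (count_space UNIV)"
  shows "(\<lambda>\<omega>. map (\<lambda>s. f s \<omega>) [0..<t]) \<in> measurable N (count_space UNIV)"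
  using assms
proof (induction t)
  case (Suc t)
  have IH: "(\<lambda>\<omega>. map (\<lambda>s. f s \<omega>) [0..<t]) \<in> measurable N (count_space UNIV)"
    using Suc by simp
  have "(\<lambda>\<omega>. h @ [f t \<omega>]) \<in> measurable N (count_space UNIV)" for h
    by (rule measurable_compose[OF Suc.prems[of t]]) simp_all
  then have "(\<lambda>\<omega>. map (\<lambda>s. f s \<omega>) [0..<t] @ [f t \<omega>]) \<in> measurable N (count_space UNIV)"
    by (rule measurable_compose_countable[OF _ IH])
  then show ?case by simp
qed simp


section \<open>The chain driven by random choices: independence and drift\<close>

locale bounding_run = prob_space M for M :: "'a measure" +
  fixes n :: nat and X :: "nat \<Rightarrow> 'a \<Rightarrow> nat \<times> nat"
  assumes n: "n \<ge> 2"
    and indep: "indep_vars (\<lambda>_. count_space UNIV) X UNIV"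
    and law: "\<And>t. distr M (count_space UNIV) (X t) = measure_pmf (choice_pmf n)"
begin

text \<open>The past as a list takes values in a countable discrete space, on which every function
  is measurable. By \<open>bounding_chain_cong\<close> it determines the state at time
  \<open>t\<close>.\<close>

definition hist :: "nat \<Rightarrow> 'a \<Rightarrow> (nat \<times> nat) list" where
  "hist t \<omega> = map (\<lambda>s. X s \<omega>) [0..<t]"

definition num_unknown :: "nat \<Rightarrow> 'a \<Rightarrow> nat" where
  "num_unknown t \<omega> = unknown n (bounding_chain n (\<lambda>s. X s \<omega>) t)"

lemma X_measurable [measurable]: "X t \<in> measurable M (count_space UNIV)"
  using indep by (auto simp: indep_vars_def)

lemma hist_measurable [measurable]: "hist t \<in> measurable M (count_space UNIV)"
  unfolding hist_def[abs_def] by (rule measurable_map_upt) simp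

lemma num_unknown_measurable [measurable]: "num_unknown t \<in> measurable M (count_space UNIV)"
proof -
  have "num_unknown t = (\<lambda>h. unknown n (bounding_chain n (nth h) t)) \<circ> hist t"
    unfolding num_unknown_def hist_def comp_def
    by (intro ext arg_cong[of _ _ "unknown n"] bounding_chain_cong) simp
  also have "\<dots> \<in> measurable M (count_space UNIV)"
    by (rule measurable_comp[OF hist_measurable]) simp
  finally show ?thesis .
qed

text \<open>The law of each choice is supported on the square, and countably many null sets can be
  discarded at once. This makes the combinatorial lemmas available almost surely.\<close>

lemma AE_X: "AE \<omega> in M. \<forall>s. X s \<omega> \<in> {1..n} \<times> {1..n}"
proof -
  have "AE \<omega> in M. X s \<omega> \<in> {1..n} \<times> {1..n}" for s
  proof -
    have "AE x in distr M (count_space UNIV) (X s). x \<in> {1..n} \<times> {1..n}"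
      unfolding law using n by (auto simp: AE_measure_pmf_iff choice_pmf_eq set_pmf_of_set)
    then show ?thesis by (subst (asm) AE_distr_iff) auto
  qed
  then show ?thesis by (simp add: AE_all_countable)
qed

text \<open>\<open>indep_var\<close> relates variables of one type, hence the singleton list.\<close>

lemma indep_hist: "indep_var (count_space UNIV) (hist t) (count_space UNIV) (\<lambda>\<omega>. [X t \<omega>])"
proof -
  let ?P = "\<lambda>A. Pi\<^sub>M A (\<lambda>_. count_space UNIV :: (nat \<times> nat) measure)"
  have *: "indep_var (?P {..<t}) (\<lambda>\<omega>. restrict (\<lambda>i. X i \<omega>) {..<t})
      (?P {t}) (\<lambda>\<omega>. restrict (\<lambda>i. X i \<omega>) {t})"
    by (rule indep_var_restrict[OF indep]) auto
  have eval: "(\<lambda>r. r s) \<in> measurable (?P A) (count_space UNIV)" if "s \<in> A" for s A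
    using measurable_component_singleton[OF that, of "\<lambda>_. count_space UNIV"] by simp
  have "(\<lambda>r. map r [0..<t]) \<in> measurable (?P {..<t}) (count_space UNIV)"
    using measurable_map_upt[of t "\<lambda>s r. r s" "?P {..<t}"] eval by simp
  then have "indep_var (count_space UNIV) ((\<lambda>r. map r [0..<t]) \<circ> (\<lambda>\<omega>. restrict (\<lambda>i. X i \<omega>) {..<t}))
      (count_space UNIV) ((\<lambda>r. [r t]) \<circ> (\<lambda>\<omega>. restrict (\<lambda>i. X i \<omega>) {t}))"
    by (intro indep_var_compose[OF *] measurable_compose[OF eval]) auto
  moreover have "(\<lambda>r. map r [0..<t]) \<circ> (\<lambda>\<omega>. restrict (\<lambda>i. X i \<omega>) {..<t}) = hist t"
    by (auto simp: hist_def fun_eq_iff)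
  moreover have "(\<lambda>r. [r t]) \<circ> (\<lambda>\<omega>. restrict (\<lambda>i. X i \<omega>) {t}) = (\<lambda>\<omega>. [X t \<omega>])"
    by (auto simp: fun_eq_iff)
  ultimately show ?thesis by simp
qed

text \<open>Independence makes the joint law of past and next choice a product, so by Fubini the
  next choice is integrated with the past frozen.\<close>

lemma nn_integral_hist:
  fixes F :: "(nat \<times> nat) list \<Rightarrow> nat \<times> nat \<Rightarrow> ennreal"
  shows "(\<integral>\<^sup>+\<omega>. F (hist t \<omega>) (X t \<omega>) \<partial>M) = (\<integral>\<^sup>+\<omega>. (\<integral>\<^sup>+x. F (hist t \<omega>) x \<partial>choice_pmf n) \<partial>M)"
proof -
  let ?L = "count_space UNIV :: (nat \<times> nat) list measure"
  let ?Z = "\<lambda>\<omega>. [X t \<omega>]"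
  \<comment> \<open>Countability makes the product sigma-algebra discrete, so every \<open>F\<close>
    is measurable on it.\<close>
  have LL: "?L \<Otimes>\<^sub>M ?L = count_space UNIV"
    by (subst pair_measure_countable) auto
  have eq: "distr M ?L (hist t) \<Otimes>\<^sub>M distr M ?L ?Z = distr M (?L \<Otimes>\<^sub>M ?L) (\<lambda>\<omega>. (hist t \<omega>, ?Z \<omega>))"
    using indep_hist[of t] by (simp add: indep_var_distribution_eq)
  interpret D: prob_space "distr M ?L ?Z" by (rule prob_space_distr) simp
  have sets: "sets (distr M ?L (hist t) \<Otimes>\<^sub>M distr M ?L ?Z) = UNIV"
    by (subst eq) (simp add: LL)
  have inner: "(\<integral>\<^sup>+l. F h (hd l) \<partial>distr M ?L ?Z) = (\<integral>\<^sup>+x. F h x \<partial>choice_pmf n)" for h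
    unfolding law[of t, symmetric] by (simp add: nn_integral_distr)
  have "(\<lambda>\<omega>. (hist t \<omega>, ?Z \<omega>)) \<in> measurable M (?L \<Otimes>\<^sub>M ?L)"
    by (intro measurable_Pair) simp_all
  then have "(\<integral>\<^sup>+\<omega>. F (hist t \<omega>) (X t \<omega>) \<partial>M)
      = (\<integral>\<^sup>+y. F (fst y) (hd (snd y)) \<partial>distr M (?L \<Otimes>\<^sub>M ?L) (\<lambda>\<omega>. (hist t \<omega>, ?Z \<omega>)))"
    by (subst nn_integral_distr) (simp_all add: LL)
  also have "\<dots> = (\<integral>\<^sup>+h. (\<integral>\<^sup>+l. F h (hd l) \<partial>distr M ?L ?Z) \<partial>distr M ?L (hist t))"
    unfolding eq[symmetric]
    by (subst D.nn_integral_fst[symmetric]) (auto simp: measurable_def sets)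
  also have "\<dots> = (\<integral>\<^sup>+\<omega>. (\<integral>\<^sup>+x. F (hist t \<omega>) x \<partial>choice_pmf n) \<partial>M)"
    unfolding inner by (subst nn_integral_distr) simp_all
  finally show ?thesis .
qed

text \<open>The Markov property for the unknown count: given the past, the state at time
  \<open>t\<close> is fixed and almost surely valid, so \<open>nn_integral_step\<close> evaluates
  the inner integral.\<close>

lemma nn_integral_drift:
  fixes f :: "nat \<Rightarrow> real"
  assumes f: "\<And>k. f k \<ge> 0"
  shows "(\<integral>\<^sup>+\<omega>. ennreal (f (num_unknown (Suc t) \<omega>)) \<partial>M) =
    (\<integral>\<^sup>+\<omega>. ennreal (f (num_unknown t \<omega>) +
      (real (num_unknown t \<omega>) / real n)\<^sup>2 * (f (num_unknown t \<omega> - 1) - f (num_unknown t \<omega>))) \<partial>M)"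
proof -
  let ?Y = "\<lambda>h. bounding_chain n (nth h) t"
  have Y: "?Y (hist t \<omega>) = bounding_chain n (\<lambda>s. X s \<omega>) t" for \<omega>
    unfolding hist_def by (rule bounding_chain_cong) simp
  have "(\<integral>\<^sup>+\<omega>. ennreal (f (num_unknown (Suc t) \<omega>)) \<partial>M)
      = (\<integral>\<^sup>+\<omega>. ennreal (f (unknown n (bounding_step n (fst (X t \<omega>)) (snd (X t \<omega>)) (?Y (hist t \<omega>))))) \<partial>M)"
    by (simp add: num_unknown_def Y)
  also have "\<dots> = (\<integral>\<^sup>+\<omega>. (\<integral>\<^sup>+x. ennreal (f (unknown n (bounding_step n (fst x) (snd x) (?Y (hist t \<omega>)))))
      \<partial>choice_pmf n) \<partial>M)"
    by (rule nn_integral_hist)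
  also have "\<dots> = (\<integral>\<^sup>+\<omega>. ennreal (f (num_unknown t \<omega>) +
      (real (num_unknown t \<omega>) / real n)\<^sup>2 * (f (num_unknown t \<omega> - 1) - f (num_unknown t \<omega>))) \<partial>M)"
    using AE_X by (intro nn_integral_cong_AE, eventually_elim)
      (subst nn_integral_step[OF _ n f], auto simp: num_unknown_def Y intro!: valid_chain[OF n])
  finally show ?thesis .
qed

lemma num_unknown_0: "num_unknown 0 \<omega> = n"
  using unknown_init[OF n] by (simp add: num_unknown_def)

lemma num_unknown_le: "num_unknown t \<omega> \<le> n"
  by (simp add: num_unknown_def unknown_le)

section \<open>Geometric bounds on the probability that something is still unknown\<close>

definition rate :: real where
  "rate = 1 / (real n)\<^sup>2"

lemma rate_bounds: "0 < rate" "rate \<le> 1/4"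
proof -
  have "(2::real)\<^sup>2 \<le> (real n)\<^sup>2" by (rule power_mono) (use n in auto)
  then show "0 < rate" "rate \<le> 1/4" using n by (auto simp: rate_def field_simps)
qed

text \<open>The weights \<open>2k/(k+1) = (\<Prod>j=2..k. j\<^sup>2 / (j\<^sup>2 - 1))\<close> form an eigenfunction of the death chain
  with rates \<open>k\<^sup>2/n\<^sup>2\<close>, for the eigenvalue \<open>1 - 1/n\<^sup>2\<close> of its slowest step.\<close>

lemma nn_integral_eigenfunction:
  "(\<integral>\<^sup>+\<omega>. ennreal (2 * real (num_unknown t \<omega>) / (real (num_unknown t \<omega>) + 1)) \<partial>M) =
    ennreal ((1 - rate) ^ t * (2 * real n / (real n + 1)))"
proof (induction t)
  case 0
  show ?case by (simp add: num_unknown_0 emeasure_space_1)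
next
  case (Suc t)
  define f :: "nat \<Rightarrow> real" where "f k = 2 * real k / (real k + 1)" for k
  \<comment> \<open>For \<open>k > 0\<close>, \<open>f (k - 1)\<close> falls short of
    \<open>f k\<close> by the fraction \<open>1 / (k * k)\<close>, which cancels the
    \<open>k * k\<close> of the transition probability and leaves \<open>rate\<close>.\<close>
  have "f k + (real k / real n)\<^sup>2 * (f (k - 1) - f k) = (1 - rate) * f k" for k
  proof (cases k)
    case (Suc m)
    then have "f (k - 1) - f k = - (f k / (real k)\<^sup>2)"
      by (simp add: f_def divide_simps power2_eq_square) (simp add: algebra_simps)
    then show ?thesis
      using Suc by (simp only:) (simp add: rate_def power_divide algebra_simps)
  qed (simp add: f_def)
  moreover have "f k \<ge> 0" for k by (simp add: f_def)
  ultimately have "(\<integral>\<^sup>+\<omega>. ennreal (f (num_unknown (Suc t) \<omega>)) \<partial>M) =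
    (\<integral>\<^sup>+\<omega>. ennreal ((1 - rate) * f (num_unknown t \<omega>)) \<partial>M)"
    using nn_integral_drift[of f t] by simp
  also have "\<dots> =
    ennreal (1 - rate) * (\<integral>\<^sup>+\<omega>. ennreal (f (num_unknown t \<omega>)) \<partial>M)"
    using rate_bounds by (subst nn_integral_cmult[symmetric]) (simp_all add: ennreal_mult')
  also have "(\<integral>\<^sup>+\<omega>. ennreal (f (num_unknown t \<omega>)) \<partial>M) =
    ennreal ((1 - rate) ^ t * (2 * real n / (real n + 1)))"
    using Suc by (simp only: f_def)
  also have "ennreal (1 - rate) * ennreal ((1 - rate) ^ t * (2 * real n / (real n + 1)))
      = ennreal ((1 - rate) ^ Suc t * (2 * real n / (real n + 1)))"
    using rate_bounds by (subst ennreal_mult'[symmetric]) (auto simp: mult_ac)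
  finally show ?case by (simp only: f_def)
qed

lemma emeasure_eq_nn_integral:
  "emeasure M {\<omega>\<in>space M. 0 < num_unknown t \<omega>} =
    (\<integral>\<^sup>+\<omega>. ennreal (of_bool (0 < num_unknown t \<omega>)) \<partial>M)"
proof -
  have "(\<integral>\<^sup>+\<omega>. ennreal (of_bool (0 < num_unknown t \<omega>)) \<partial>M) =
    (\<integral>\<^sup>+\<omega>. indicator {\<omega>\<in>space M. 0 < num_unknown t \<omega>} \<omega> \<partial>M)"
    by (rule nn_integral_cong) (auto split: split_indicator)
  also have "\<dots> = emeasure M {\<omega>\<in>space M. 0 < num_unknown t \<omega>}"
    by (rule nn_integral_indicator) measurable
  finally show ?thesis by simp
qed

text \<open>The eigenfunction vanishes at 0 and is at least 1 from 1 on, so it dominates the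
  indicator; its initial value \<open>2 * n / (n + 1)\<close> is below 2.\<close>

lemma emeasure_unknown_upper: "emeasure M {\<omega>\<in>space M. 0 < num_unknown t \<omega>} \<le> ennreal (2 * (1 - rate) ^ t)"
proof -
  have "emeasure M {\<omega>\<in>space M. 0 < num_unknown t \<omega>} \<le>
      (\<integral>\<^sup>+\<omega>. ennreal (2 * real (num_unknown t \<omega>) / (real (num_unknown t \<omega>) + 1)) \<partial>M)"
    unfolding emeasure_eq_nn_integral by (intro nn_integral_mono ennreal_leI) (auto simp: field_simps)
  also have "\<dots> \<le> ennreal (2 * (1 - rate) ^ t)"
    unfolding nn_integral_eigenfunction using rate_bounds
    by (intro ennreal_leI) (auto simp: field_simps)
  finally show ?thesis .
qed

text \<open>A single step reaches 0 only from count 1, and then with probability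
  \<open>rate\<close>. From any positive count the chain therefore survives a step with probability
  at least \<open>1 - rate\<close>.\<close>

lemma emeasure_unknown_lower: "ennreal ((1 - rate) ^ t) \<le> emeasure M {\<omega>\<in>space M. 0 < num_unknown t \<omega>}"
proof (induction t)
  case 0
  show ?case using n by (simp add: num_unknown_0 emeasure_space_1)
next
  case (Suc t)
  define f :: "nat \<Rightarrow> real" where "f k = of_bool (0 < k)" for k
  have "(1 - rate) * f k \<le> f k + (real k / real n)\<^sup>2 * (f (k - 1) - f k)" for k
    using rate_bounds by (cases "k = 1") (auto simp: f_def rate_def field_simps)
  then have "(\<integral>\<^sup>+\<omega>. ennreal ((1 - rate) * f (num_unknown t \<omega>)) \<partial>M) \<le>
      (\<integral>\<^sup>+\<omega>. ennreal (f (num_unknown (Suc t) \<omega>)) \<partial>M)"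
    by (subst nn_integral_drift) (auto simp: f_def[abs_def] intro!: nn_integral_mono ennreal_leI)
  moreover have "(\<integral>\<^sup>+\<omega>. ennreal ((1 - rate) * f (num_unknown t \<omega>)) \<partial>M) =
    ennreal (1 - rate) * (\<integral>\<^sup>+\<omega>. ennreal (f (num_unknown t \<omega>)) \<partial>M)"
    using rate_bounds by (subst nn_integral_cmult[symmetric]) (simp_all add: ennreal_mult')
  moreover have "ennreal ((1 - rate) ^ Suc t) \<le>
      ennreal (1 - rate) * (\<integral>\<^sup>+\<omega>. ennreal (f (num_unknown t \<omega>)) \<partial>M)"
    using mult_left_mono[OF Suc, of "ennreal (1 - rate)"] rate_bounds
    by (simp add: f_def ennreal_mult' emeasure_eq_nn_integral)
  ultimately show ?case by (simp add: f_def emeasure_eq_nn_integral)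
qed

section \<open>Bounds on the sum of the tail probabilities\<close>

definition mean_time :: "nat \<Rightarrow> real" where
  "mean_time k = (\<Sum>j=1..k. (real n)\<^sup>2 / (real j)\<^sup>2)"

text \<open>A conservation law: \<open>mean_time\<close> is the expected remaining time, and each
  step taken before absorption lowers it by exactly 1 on average. Expected time spent plus expected
  time left stays constant.\<close>

lemma sum_emeasure_unknown:
  "(\<Sum>t<N. emeasure M {\<omega>\<in>space M. 0 < num_unknown t \<omega>}) +
    (\<integral>\<^sup>+\<omega>. ennreal (mean_time (num_unknown N \<omega>)) \<partial>M) = ennreal (mean_time n)"
proof (induction N)
  case 0
  show ?case by (simp add: num_unknown_0 emeasure_space_1)
next
  case (Suc N)
  have mean_nonneg: "mean_time k \<ge> 0" for k by (auto simp: mean_time_def intro!: sum_nonneg)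
  have drift: "of_bool (0 < k) +
      (mean_time k + (real k / real n)\<^sup>2 * (mean_time (k - 1) - mean_time k)) = mean_time k" for k
    using n by (cases k) (simp_all add: mean_time_def field_simps)
  \<comment> \<open>Needed to merge two \<open>ennreal\<close> terms, since \<open>ennreal\<close>
    cuts negative reals to 0. The bound \<open>k \<le> n\<close> keeps the transition probability at
    most 1.\<close>
  have nonneg: "mean_time k + (real k / real n)\<^sup>2 * (mean_time (k - 1) - mean_time k) \<ge> 0" if "k \<le> n" for k
  proof -
    have "(real k / real n)\<^sup>2 \<le> 1"
      using that n by (intro power_le_one) auto
    then have "(real k / real n)\<^sup>2 * mean_time k \<le> mean_time k"
      using mean_nonneg[of k] by (simp add: mult_left_le_one_le)
    moreover have "0 \<le> (real k / real n)\<^sup>2 * mean_time (k - 1)" using mean_nonneg by simp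
    ultimately show ?thesis by (simp add: algebra_simps)
  qed
  have "emeasure M {\<omega>\<in>space M. 0 < num_unknown N \<omega>} +
        (\<integral>\<^sup>+\<omega>. ennreal (mean_time (num_unknown (Suc N) \<omega>)) \<partial>M)
      = (\<integral>\<^sup>+\<omega>. ennreal (of_bool (0 < num_unknown N \<omega>)) +
          ennreal (mean_time (num_unknown N \<omega>) +
            (real (num_unknown N \<omega>) / real n)\<^sup>2 * (mean_time (num_unknown N \<omega> - 1) - mean_time (num_unknown N \<omega>))) \<partial>M)"
    unfolding nn_integral_drift[of mean_time, OF mean_nonneg] emeasure_eq_nn_integral
    by (rule nn_integral_add[symmetric]) measurable
  also have "\<dots> = (\<integral>\<^sup>+\<omega>. ennreal (mean_time (num_unknown N \<omega>)) \<partial>M)"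
    by (intro nn_integral_cong, subst ennreal_plus[symmetric])
      (simp_all only: nonneg num_unknown_le drift zero_less_eq_of_bool)
  finally show ?case using Suc by (simp add: add.assoc)
qed

text \<open>Dropping the expected remaining time bounds every partial sum by
  \<open>mean_time n\<close>, and the Basel series bounds that.\<close>

lemma suminf_emeasure_unknown_le:
  "(\<Sum>t. emeasure M {\<omega>\<in>space M. 0 < num_unknown t \<omega>}) \<le> ennreal (pi\<^sup>2 / 6 * (real n)\<^sup>2)"
proof -
  have "(\<Sum>t<N. emeasure M {\<omega>\<in>space M. 0 < num_unknown t \<omega>}) \<le> ennreal (mean_time n)" for N
    by (rule order_trans[OF _ eq_refl[OF sum_emeasure_unknown[of N]]]) (simp add: add_increasing2)
  then have "(\<Sum>t. emeasure M {\<omega>\<in>space M. 0 < num_unknown t \<omega>}) \<le> ennreal (mean_time n)"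
    by (intro suminf_le_const) auto
  also have "mean_time n \<le> pi\<^sup>2 / 6 * (real n)\<^sup>2"
  proof -
    have "(\<Sum>j<n. 1 / (real j + 1)\<^sup>2) \<le> pi\<^sup>2 / 6"
      using inverse_squares_sums by (intro sum_le_suminf[THEN order_trans]) (auto simp: sums_iff add_ac)
    then have "(real n)\<^sup>2 * (\<Sum>j<n. 1 / (real j + 1)\<^sup>2) \<le> (real n)\<^sup>2 * (pi\<^sup>2 / 6)"
      by (rule mult_left_mono) simp
    moreover have "mean_time n = (real n)\<^sup>2 * (\<Sum>j<n. 1 / (real j + 1)\<^sup>2)"
      unfolding mean_time_def sum_distrib_left
      by (rule sum.reindex_bij_witness[of _ Suc "\<lambda>j. j - 1"]) auto
    ultimately show ?thesis by (simp add: mult.commute)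
  qed
  finally show ?thesis by (simp add: ennreal_leI)
qed

text \<open>Sums the geometric lower bound. The resulting lower bound on the expectation makes the
  time \<open>C * E\<tau>\<close> in the tail estimate at least \<open>C * n * n\<close>.\<close>

lemma suminf_emeasure_unknown_ge:
  "ennreal ((real n)\<^sup>2) \<le> (\<Sum>t. emeasure M {\<omega>\<in>space M. 0 < num_unknown t \<omega>})"
proof -
  have "(\<lambda>t. (1 - rate) ^ t) sums (1 / (1 - (1 - rate)))"
    using rate_bounds by (intro geometric_sums) auto
  then have "(\<lambda>t. (1 - rate) ^ t) sums (real n)\<^sup>2" by (simp add: rate_def)
  then have "(\<Sum>t. ennreal ((1 - rate) ^ t)) = ennreal ((real n)\<^sup>2)"
    using rate_bounds by (intro suminf_ennreal_eq) auto
  moreover have "(\<Sum>t. ennreal ((1 - rate) ^ t)) \<le> (\<Sum>t. emeasure M {\<omega>\<in>space M. 0 < num_unknown t \<omega>})"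
    by (intro suminf_le emeasure_unknown_lower) auto
  ultimately show ?thesis by simp
qed

section \<open>Transfer to the detection time\<close>

lemma expected_detection_time:
  "(\<integral>\<^sup>+\<omega>. ennreal_of_enat (detection_time n (\<lambda>t. X t \<omega>)) \<partial>M) =
    (\<Sum>t. emeasure M {\<omega>\<in>space M. 0 < num_unknown t \<omega>})"
proof -
  have "AE \<omega> in M. \<forall>t. enat t < detection_time n (\<lambda>t. X t \<omega>) \<longleftrightarrow> 0 < num_unknown t \<omega>"
    using AE_X
  proof eventually_elim
    case (elim \<omega>)
    then have mono: "num_unknown t \<omega> \<le> num_unknown s \<omega>" if "s \<le> t" for s t
      unfolding num_unknown_def using that by (intro unknown_chain_antimono[OF n]) blast
    \<comment> \<open>Along almost every trajectory the count never grows, so only the last time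
      \<open>t\<close> matters.\<close>
    have "(\<forall>s\<le>t. num_unknown s \<omega> \<noteq> 0) \<longleftrightarrow> 0 < num_unknown t \<omega>" for t
    proof
      assume "0 < num_unknown t \<omega>"
      then show "\<forall>s\<le>t. num_unknown s \<omega> \<noteq> 0"
        using mono by fastforce
    qed simp
    then show ?case
      unfolding less_detection_time_iff by (simp add: num_unknown_def)
  qed
  then have "(\<integral>\<^sup>+\<omega>. ennreal_of_enat (detection_time n (\<lambda>t. X t \<omega>)) \<partial>M)
      = (\<integral>\<^sup>+\<omega>. (\<Sum>t. ennreal (of_bool (0 < num_unknown t \<omega>))) \<partial>M)"
    unfolding ennreal_of_enat_eq_suminf
    by (intro nn_integral_cong_AE) (auto elim!: eventually_mono simp: of_bool_def intro!: suminf_cong)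
  also have "\<dots> = (\<Sum>t. \<integral>\<^sup>+\<omega>. ennreal (of_bool (0 < num_unknown t \<omega>)) \<partial>M)"
    by (rule nn_integral_suminf) measurable
  finally show ?thesis by (simp add: emeasure_eq_nn_integral)
qed

lemma detection_time_tail:
  fixes C \<mu> :: real
  assumes C: "C \<ge> 2" and \<mu>: "\<mu> \<ge> (real n)\<^sup>2"
  shows "measure M {\<omega> \<in> space M. ennreal_of_enat (detection_time n (\<lambda>t. X t \<omega>)) > ennreal (C * \<mu>)}
    \<le> exp (- 0.18 * C)"
proof -
  \<comment> \<open>Detection times are integers, so rounding down loses no part of the event; it
    costs at most one step in the exponent.\<close>
  define t where "t = nat \<lfloor>C * \<mu>\<rfloor>"
  have "C * \<mu> \<ge> 0" using assms by (simp add: order_trans[OF zero_le_power2])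
  then have "real t = real_of_int \<lfloor>C * \<mu>\<rfloor>" by (simp add: t_def)
  then have t: "real t \<le> C * \<mu>" "C * \<mu> - 1 \<le> real t" by linarith+
  have "measure M {\<omega> \<in> space M. ennreal_of_enat (detection_time n (\<lambda>t. X t \<omega>)) > ennreal (C * \<mu>)}
      \<le> measure M {\<omega> \<in> space M. 0 < num_unknown t \<omega>}"
  proof (rule finite_measure_mono)
    have "0 < num_unknown t \<omega>" if gt: "ennreal (C * \<mu>) < ennreal_of_enat (detection_time n (\<lambda>t. X t \<omega>))" for \<omega>
    proof (rule ccontr)
      assume 0: "\<not> 0 < num_unknown t \<omega>"
      from 0 have "detection_time n (\<lambda>t. X t \<omega>) \<le> enat t"
        using less_detection_time_iff[of t n "\<lambda>t. X t \<omega>"] by (auto simp: num_unknown_def not_less[symmetric])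
      then have "ennreal_of_enat (detection_time n (\<lambda>t. X t \<omega>)) \<le> ennreal (real t)"
        by (metis ennreal_of_enat_enat ennreal_of_enat_le_iff ennreal_of_nat_eq_real_of_nat)
      also have "\<dots> \<le> ennreal (C * \<mu>)" using t by (intro ennreal_leI)
      finally show False using gt by simp
    qed
    then show "{\<omega> \<in> space M. ennreal_of_enat (detection_time n (\<lambda>t. X t \<omega>)) > ennreal (C * \<mu>)}
        \<subseteq> {\<omega> \<in> space M. 0 < num_unknown t \<omega>}"
      by blast
  qed measurable
  also have "\<dots> \<le> 2 * (1 - rate) ^ t"
    using emeasure_unknown_upper[of t] rate_bounds by (simp add: emeasure_eq_measure)
  also have "\<dots> \<le> 2 * exp (- rate) ^ t"
    using rate_bounds exp_ge_add_one_self[of "- rate"] by (intro mult_left_mono power_mono) auto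
  also have "\<dots> = exp (ln 2 - rate * t)"
    by (simp add: exp_diff exp_minus divide_inverse exp_of_nat_mult[symmetric] power_inverse mult_ac)
  also have "\<dots> \<le> exp (- 0.18 * C)"
  proof -
    \<comment> \<open>Since \<open>rate * \<mu> \<ge> 1\<close>, the exponent is at most
      \<open>ln 2 + rate - C\<close>. What remains is \<open>ln 2 + rate \<le> 0.82 * C\<close>: the
      left side is at most \<open>25/36 + 1/4 < 1\<close>, the right side at least
      \<open>1.64\<close>.\<close>
    have "rate * (C * \<mu> - 1) \<le> rate * t" using t rate_bounds by (intro mult_left_mono) auto
    moreover have "C \<le> rate * (C * \<mu>)"
      using \<mu> C n by (simp add: rate_def field_simps)
    ultimately have "C - rate \<le> rate * t" by (simp add: algebra_simps)
    then show ?thesis using C rate_bounds ln2_le_25_over_36 by simp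
  qed
  finally show ?thesis .
qed

end

theorem lemma1:
  fixes n :: nat and M :: "'a measure" and X :: "nat \<Rightarrow> 'a \<Rightarrow> nat \<times> nat"
    and \<tau> :: "'a \<Rightarrow> ennreal" and E\<tau> :: ennreal
  assumes n: "n \<ge> 1"
    and M: "prob_space M"
    and indep: "prob_space.indep_vars M (\<lambda>_. count_space UNIV) X UNIV"
    and law: "\<And>t. distr M (count_space UNIV) (X t) = measure_pmf (choice_pmf n)"
  defines "\<tau> \<equiv> \<lambda>\<omega>. ennreal_of_enat (detection_time n (\<lambda>t. X t \<omega>))"
    and "E\<tau> \<equiv> \<integral>\<^sup>+ \<omega>. \<tau> \<omega> \<partial>M"
  shows "E\<tau> \<le> ennreal (pi\<^sup>2 / 6 * (real n)\<^sup>2) \<and>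
    (\<forall>C::real. C \<ge> 2 \<longrightarrow>
       measure M {\<omega> \<in> space M. \<tau> \<omega> > ennreal C * E\<tau>} \<le> exp (- 0.18 * C))"
proof (cases "n = 1")
  case True
  then have "unknown n (bounding_chain n (\<lambda>t. X t \<omega>) 0) = 0" for \<omega>
    by (simp add: unknown_def bounding_init_def)
  then have "\<not> enat 0 < detection_time n (\<lambda>t. X t \<omega>)" for \<omega>
    unfolding less_detection_time_iff by blast
  then have "\<tau> \<omega> = 0" for \<omega>
    by (simp add: \<tau>_def enat_0)
  \<comment> \<open>Both \<open>\<tau>\<close> and its mean are 0, so the tail event, having a
    strict inequality, is empty.\<close>
  then show ?thesis by (simp add: E\<tau>_def)
next
  case False
  interpret prob_space M by (rule M)
  interpret bounding_run M n X
    using False n indep law by unfold_locales auto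
  have E: "E\<tau> = (\<Sum>t. emeasure M {\<omega>\<in>space M. 0 < num_unknown t \<omega>})"
    unfolding E\<tau>_def \<tau>_def by (rule expected_detection_time)
  have upper: "E\<tau> \<le> ennreal (pi\<^sup>2 / 6 * (real n)\<^sup>2)"
    unfolding E by (rule suminf_emeasure_unknown_le)
  \<comment> \<open>The upper bound makes the expectation finite, so \<open>C * E\<tau>\<close>
    becomes a product of reals.\<close>
  then obtain \<mu> where \<mu>: "E\<tau> = ennreal \<mu>" "\<mu> \<ge> 0"
    by (cases E\<tau>) (auto simp: top_unique)
  then have "\<mu> \<ge> (real n)\<^sup>2"
    using suminf_emeasure_unknown_ge unfolding E[symmetric] by simp
  have "measure M {\<omega> \<in> space M. \<tau> \<omega> > ennreal C * E\<tau>} \<le> exp (- 0.18 * C)" if C: "C \<ge> 2" for C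
  proof -
    have "ennreal C * E\<tau> = ennreal (C * \<mu>)" using C \<mu> by (simp add: ennreal_mult)
    with detection_time_tail[OF C \<open>\<mu> \<ge> (real n)\<^sup>2\<close>] show ?thesis by (simp only: \<tau>_def)
  qed
  with upper show ?thesis by blast
qed

end
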